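(* Let $n>3$ be an odd integer and let $$f_{n,1}(x)=\sum_{j\geq 0}\binom{n-1}{2j+1}(x^j-x^{j+1})+2\sum_{j\geq 0}\binom{n}{2j}x^j\in\mathbb{Z}[x],\qquad C_n(x):=f_{n,1}(x)-(n+1)x^{(n-1)/2}.$$ Then, with $N=(n-1)/2$, $C_n(x)$ viewed as an element of $\mathbb{Z}[x]/(x^N-1)$ is a coterm polynomial.
   Context: For a commutative ring $R$ with identity and $N\ge1$, a polynomial $a_0+a_1x+\cdots+a_{N-1}x^{N-1}\in R[x]/(x^N-1)$ with $a_i\in R$ is a coterm polynomial if $a_i=a_{N-i}$ for all $1\le i\le\lfloor N/2\rfloor$. Binomial coefficients $\binom{a}{b}$ are $0$ when $b>a$. *)

theory Defs
  imports "HOL-Computational_Algebra.Polynomial"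
begin

text \<open>
  The quotient ring \<open>R[x]/(x^N - 1)\<close> is the set \<open>UNIV // cyclic_rel N\<close>: an element of it is the
  coset of a polynomial modulo the principal ideal generated by \<open>x^N - 1\<close>.
\<close>

definition cyclic_rel :: "nat \<Rightarrow> ('a::comm_ring_1 poly \<times> 'a poly) set" where
  "cyclic_rel N = {(p, q). (monom 1 N - 1) dvd (p - q)}"

lemma equiv_cyclic_rel: "equiv UNIV (cyclic_rel N :: ('a::comm_ring_1 poly \<times> 'a poly) set)"
proof (rule equivI)
  show "refl (cyclic_rel N :: ('a poly \<times> 'a poly) set)"
    by (auto simp: refl_on_def cyclic_rel_def)
  show "sym (cyclic_rel N :: ('a poly \<times> 'a poly) set)"
    unfolding sym_def cyclic_rel_def
    by (metis (mono_tags, lifting) case_prod_conv dvd_minus_iff mem_Collect_eq minus_diff_eq)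
  show "trans (cyclic_rel N :: ('a poly \<times> 'a poly) set)"
  proof (rule transI)
    fix p q r :: "'a poly"
    assume "(p, q) \<in> cyclic_rel N" "(q, r) \<in> cyclic_rel N"
    then have "(monom 1 N - 1) dvd (p - q)" "(monom 1 N - 1) dvd (q - r)"
      by (simp_all add: cyclic_rel_def)
    then have "(monom 1 N - 1) dvd (p - q) + (q - r)"
      by (rule dvd_add)
    then show "(p, r) \<in> cyclic_rel N"
      by (simp add: cyclic_rel_def)
  qed
qed simp

definition cyclic_class :: "nat \<Rightarrow> 'a::comm_ring_1 poly \<Rightarrow> 'a poly set" where
  "cyclic_class N p = cyclic_rel N `` {p}"

text \<open>
  For \<open>N \<ge> 1\<close> the coefficients \<open>a 0, \<dots>, a (N - 1)\<close> are uniquely determined by the element \<open>A\<close>,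
  because \<open>x^N - 1\<close> is monic of degree \<open>N\<close>; the values \<open>a i\<close> with \<open>i \<ge> N\<close> play no role.
\<close>

definition coterm :: "nat \<Rightarrow> 'a::comm_ring_1 poly set \<Rightarrow> bool" where
  "coterm N A \<longleftrightarrow>
     (\<exists>a. A = cyclic_class N (\<Sum>i<N. monom (a i) i) \<and> (\<forall>i\<in>{1..N div 2}. a i = a (N - i)))"

text \<open>
  The sums over all \<open>j \<ge> 0\<close> are cut off at \<open>j = n\<close>; all later terms vanish because their
  binomial coefficients do.
\<close>

definition f1_poly :: "nat \<Rightarrow> int poly" where
  "f1_poly n =
     (\<Sum>j\<le>n. of_nat ((n - 1) choose (2 * j + 1)) * (monom 1 j - monom 1 (j + 1)))
     + 2 * (\<Sum>j\<le>n. of_nat (n choose (2 * j)) * monom 1 j)"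

definition C_poly :: "nat \<Rightarrow> int poly" where
  "C_poly n = f1_poly n - (of_nat n + 1) * monom 1 ((n - 1) div 2)"

end

theory Submission
  imports Defs
begin

text \<open>
  By Pascal's rule, for \<open>n = 2N + 1\<close> the coefficient of \<open>x^j\<close> in \<open>f_{n,1}\<close> is \<open>binom(2N + 2, 2j + 1)\<close>.
  The subtracted monomial cancels exactly the top term \<open>j = N\<close>, so \<open>C_n\<close> is already reduced
  modulo \<open>x^N - 1\<close>, and \<open>j \<mapsto> N - j\<close> is the symmetry of the row \<open>2N + 2\<close>.
\<close>

text \<open>The shift \<open>k\<close> lets one formula cover the sums over \<open>x^j\<close> and
  over \<open>x^(j+1)\<close>.\<close>

lemma coeff_sum_of_nat_mult_monom:
  "coeff (\<Sum>j\<le>n. of_nat (f j) * monom 1 (j + k) :: 'a::comm_semiring_1 poly) m =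
     (if k \<le> m \<and> m \<le> n + k then of_nat (f (m - k)) else 0)"
proof -
  have "coeff (\<Sum>j\<le>n. of_nat (f j) * monom 1 (j + k) :: 'a poly) m =
      (\<Sum>j\<le>n. if j + k = m then of_nat (f j) else 0)"
    by (auto simp: coeff_sum of_nat_poly intro!: sum.cong)
  \<comment> \<open>Subtraction on \<open>nat\<close> truncates, hence the guard
    \<open>k \<le> m\<close>.\<close>
  also have "\<dots> = (\<Sum>j\<le>n. if j = m - k then (if k \<le> m then of_nat (f j) else 0) else 0)"
    by (intro sum.cong) auto
  also have "\<dots> = (if k \<le> m \<and> m \<le> n + k then of_nat (f (m - k)) else 0)"
    by auto
  finally show ?thesis .
qed

lemma coeff_f1_poly_odd:
  "coeff (f1_poly (2 * N + 1)) m = of_nat ((2 * N + 2) choose (2 * m + 1))"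
proof -
  let ?n = "2 * N + 1"
  have f1: "f1_poly ?n =
      (\<Sum>j\<le>?n. of_nat ((?n - 1) choose (2 * j + 1)) * monom 1 (j + 0))
      - (\<Sum>j\<le>?n. of_nat ((?n - 1) choose (2 * j + 1)) * monom 1 (j + 1))
      + smult 2 (\<Sum>j\<le>?n. of_nat (?n choose (2 * j)) * monom 1 (j + 0))"
    by (simp add: f1_poly_def right_diff_distrib sum_subtractf numeral_poly)
  show ?thesis
    unfolding f1 coeff_add coeff_diff coeff_smult coeff_sum_of_nat_mult_monom
    \<comment> \<open>For \<open>m = 0\<close> the shifted sum contributes nothing; otherwise
      Pascal's rule turns \<open>binom(2N, 2m+1) - binom(2N, 2m-1) + 2 binom(2N+1, 2m)\<close> into
      \<open>binom(2N+2, 2m+1)\<close>. Past the cut-offs all binomials vanish.\<close>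
    by (cases m) (auto simp: numeral_eq_Suc binomial_eq_0)
qed

lemma C_poly_odd:
  "C_poly (2 * N + 1) = (\<Sum>i<N. monom (int ((2 * N + 2) choose (2 * i + 1))) i)"
proof (rule poly_eqI)
  fix m
  have "coeff (\<Sum>i<N. monom (int ((2 * N + 2) choose (2 * i + 1))) i) m =
      (if m < N then int ((2 * N + 2) choose (2 * m + 1)) else 0)"
    by (simp add: coeff_sum)
  moreover have "coeff ((of_nat (2 * N + 1) + 1) * monom 1 N) m = (if m = N then 2 * int N + 2 else 0)"
  proof -
    have "(of_nat (2 * N + 1) + 1 :: int poly) = of_nat (2 * N + 2)" by simp
    then show ?thesis by (simp add: of_nat_poly del: of_nat_add of_nat_mult)
  qed
  \<comment> \<open>At \<open>m = N\<close> this equals the subtracted \<open>n + 1\<close>.\<close>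
  moreover have "(2 * N + 2) choose (2 * N + 1) = 2 * N + 2"
    using binomial_Suc_n[of "2 * N + 1"] by simp
  moreover have "(2 * N + 2) choose (2 * m + 1) = 0" if "m > N"
    using that by (intro binomial_eq_0) simp
  ultimately show "coeff (C_poly (2 * N + 1)) m =
      coeff (\<Sum>i<N. monom (int ((2 * N + 2) choose (2 * i + 1))) i) m"
    unfolding C_poly_def coeff_diff coeff_f1_poly_odd
    by (cases m N rule: linorder_cases) (simp_all del: binomial_Suc_Suc)
qed

theorem theorem5p5:
  fixes n N :: nat
  assumes "n > 3" and "odd n" and "N = (n - 1) div 2"
  shows "coterm N (cyclic_class N (C_poly n))"
proof -
  let ?a = "\<lambda>i. int ((2 * N + 2) choose (2 * i + 1))"
  have n: "n = 2 * N + 1"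
    using assms by (auto elim: oddE)
  have "?a i = ?a (N - i)" if "i \<in> {1..N div 2}" for i
  proof -
    have "i \<le> N" using that by auto
    \<comment> \<open>The row index is even, so the complement of an odd index is odd.\<close>
    then have "2 * N + 2 - (2 * i + 1) = 2 * (N - i) + 1" by simp
    then show ?thesis
      using binomial_symmetric[of "2 * i + 1" "2 * N + 2"] \<open>i \<le> N\<close> by simp
  qed
  then show ?thesis
    unfolding coterm_def n C_poly_odd by (intro exI[of _ ?a]) blast
qed

end
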